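(* Let $S$ be a finite nonempty subset of $\mathbb{Z}^2$. Then $S$ is an antimatroidal point set if and only if $S$ is orthogonally convex, $N_4$-connected, and bounded by two monotone increasing $N_4$-paths between $(0,0)$ and $(x_{\max},y_{\max})$, i.e. $(0,0)\in S$ and each of $\mathcal{B}_{lower}$ and $\mathcal{B}_{upper}$, with its points listed in lexicographic order, is a monotone increasing $N_4$-path starting at $(0,0)$ and ending at $(x_{\max},y_{\max})$, where $x_{\max}$ and $y_{\max}$ are the maximum $x$- and $y$-coordinates of points of $S$.
   Context: A point $A=(x_A,y_A)\in\mathbb{Z}^2$ is regarded as a multiset over $\{x,y\}$ ($x_A$ copies of $x$, $y_A$ copies of $y$). Write $A\subseteq B$ if $x_A\le x_B$ and $y_A\le y_B$; $A\subset B$ if $A\subseteq B$ and $A\neq B$. A finite nonempty set $S\subseteq\mathbb{Z}^2$ is an antimatroidal point set if (A1) for every $(x_A,y_A)\in S$ with $(x_A,y_A)\neq(0,0)$, either $(x_A-1,y_A)\in S$ or $(x_A,y_A-1)\in S$; (A2) for all $A,B\in S$ with $A\not\subseteq B$: if $x_A\ge x_B$ and $y_A\ge y_B$ then $(x_B+1,y_B)\in S$ or $(x_B,y_B+1)\in S$; if $x_A\le x_B$ and $y_A\ge y_B$ then $(x_B,y_B+1)\in S$; if $x_A\ge x_B$ and $y_A\le y_B$ then $(x_B+1,y_B)\in S$. $N_4(x,y)=\{(x\pm1,y),(x,y\pm1)\}$. An $N_4$-path is a sequence $A_0,\dots,A_n$ with $A_i\in N_4(A_{i-1})$; it is monotone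 increasing if $A_i\subset A_{i+1}$ for all $i$. $S$ is $N_4$-connected if any two points of $S$ are joined by an $N_4$-path all of whose points lie in $S$. $S$ is orthogonally convex if for every horizontal or vertical line $L$, $S\cap L$ is empty, a point, or a set of consecutive lattice points on $L$. Lower and upper boundaries: $\mathcal{B}_{lower}=\{(x,y)\in S:(x+1,y)\notin S\ \vee\ (x,y-1)\notin S\ \vee\ (x+1,y-1)\notin S\}$, $\mathcal{B}_{upper}=\{(x,y)\in S:(x-1,y)\notin S\ \vee\ (x,y+1)\notin S\ \vee\ (x-1,y+1)\notin S\}$. *)

theory Defs
  imports Main "HOL-Library.Product_Lexorder"
begin

type_synonym point = "int \<times> int"

text \<open>Product_Lexorder makes \<open>\<le>\<close> on points the lexicographic order; the multiset inclusion
  of points is therefore given its own symbol.\<close>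

definition point_subseteq :: "point \<Rightarrow> point \<Rightarrow> bool" (infix \<open>\<sqsubseteq>\<^sub>p\<close> 50) where
  "A \<sqsubseteq>\<^sub>p B \<longleftrightarrow> fst A \<le> fst B \<and> snd A \<le> snd B"

definition point_subset :: "point \<Rightarrow> point \<Rightarrow> bool" (infix \<open>\<sqsubset>\<^sub>p\<close> 50) where
  "A \<sqsubset>\<^sub>p B \<longleftrightarrow> A \<sqsubseteq>\<^sub>p B \<and> A \<noteq> B"

definition antimatroidal_A1 :: "point set \<Rightarrow> bool" where
  "antimatroidal_A1 S \<longleftrightarrow>
    (\<forall>(x, y) \<in> S. (x, y) \<noteq> (0, 0) \<longrightarrow> (x - 1, y) \<in> S \<or> (x, y - 1) \<in> S)"

definition antimatroidal_A2 :: "point set \<Rightarrow> bool" where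
  "antimatroidal_A2 S \<longleftrightarrow>
    (\<forall>(x\<^sub>A, y\<^sub>A) \<in> S. \<forall>(x\<^sub>B, y\<^sub>B) \<in> S. \<not> (x\<^sub>A, y\<^sub>A) \<sqsubseteq>\<^sub>p (x\<^sub>B, y\<^sub>B) \<longrightarrow>
      (x\<^sub>A \<ge> x\<^sub>B \<and> y\<^sub>A \<ge> y\<^sub>B \<longrightarrow> (x\<^sub>B + 1, y\<^sub>B) \<in> S \<or> (x\<^sub>B, y\<^sub>B + 1) \<in> S) \<and>
      (x\<^sub>A \<le> x\<^sub>B \<and> y\<^sub>A \<ge> y\<^sub>B \<longrightarrow> (x\<^sub>B, y\<^sub>B + 1) \<in> S) \<and>
      (x\<^sub>A \<ge> x\<^sub>B \<and> y\<^sub>A \<le> y\<^sub>B \<longrightarrow> (x\<^sub>B + 1, y\<^sub>B) \<in> S))"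

definition antimatroidal_point_set :: "point set \<Rightarrow> bool" where
  "antimatroidal_point_set S \<longleftrightarrow>
    finite S \<and> S \<noteq> {} \<and> antimatroidal_A1 S \<and> antimatroidal_A2 S"

fun N4 :: "point \<Rightarrow> point set" where
  "N4 (x, y) = {(x + 1, y), (x - 1, y), (x, y + 1), (x, y - 1)}"

definition N4_path :: "point list \<Rightarrow> bool" where
  "N4_path ps \<longleftrightarrow> ps \<noteq> [] \<and> (\<forall>i. Suc i < length ps \<longrightarrow> ps ! Suc i \<in> N4 (ps ! i))"

definition monotone_N4_path :: "point list \<Rightarrow> bool" where
  "monotone_N4_path ps \<longleftrightarrow>
    N4_path ps \<and> (\<forall>i. Suc i < length ps \<longrightarrow> ps ! i \<sqsubset>\<^sub>p ps ! Suc i)"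

definition N4_connected :: "point set \<Rightarrow> bool" where
  "N4_connected S \<longleftrightarrow>
    (\<forall>A \<in> S. \<forall>B \<in> S. \<exists>ps. N4_path ps \<and> hd ps = A \<and> last ps = B \<and> set ps \<subseteq> S)"

text \<open>Only the lines through lattice points matter, since all others miss the lattice.\<close>

definition horizontal_line :: "int \<Rightarrow> point set" where
  "horizontal_line c = {(x, y). y = c}"

definition vertical_line :: "int \<Rightarrow> point set" where
  "vertical_line c = {(x, y). x = c}"

definition orthogonally_convex :: "point set \<Rightarrow> bool" where
  "orthogonally_convex S \<longleftrightarrow>
    (\<forall>c. S \<inter> horizontal_line c = {} \<or> (\<exists>P. S \<inter> horizontal_line c = {P}) \<or>
         (\<exists>a b. S \<inter> horizontal_line c = {(x, c) | x. a \<le> x \<and> x \<le> b})) \<and>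
    (\<forall>c. S \<inter> vertical_line c = {} \<or> (\<exists>P. S \<inter> vertical_line c = {P}) \<or>
         (\<exists>a b. S \<inter> vertical_line c = {(c, y) | y. a \<le> y \<and> y \<le> b}))"

definition lower_boundary :: "point set \<Rightarrow> point set" where
  "lower_boundary S =
    {(x, y). (x, y) \<in> S \<and> ((x + 1, y) \<notin> S \<or> (x, y - 1) \<notin> S \<or> (x + 1, y - 1) \<notin> S)}"

definition upper_boundary :: "point set \<Rightarrow> point set" where
  "upper_boundary S =
    {(x, y). (x, y) \<in> S \<and> ((x - 1, y) \<notin> S \<or> (x, y + 1) \<notin> S \<or> (x - 1, y + 1) \<notin> S)}"

definition x_max :: "point set \<Rightarrow> int" where
  "x_max S = Max (fst ` S)"

definition y_max :: "point set \<Rightarrow> int" where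
  "y_max S = Max (snd ` S)"

definition monotone_N4_path_between :: "point \<Rightarrow> point \<Rightarrow> point list \<Rightarrow> bool" where
  "monotone_N4_path_between A B ps \<longleftrightarrow> monotone_N4_path ps \<and> hd ps = A \<and> last ps = B"

text \<open>By the instance from Product_Lexorder, \<open>sorted_list_of_set\<close> lists a finite set of points
  in lexicographic order.\<close>

definition bounded_by_monotone_N4_paths :: "point set \<Rightarrow> bool" where
  "bounded_by_monotone_N4_paths S \<longleftrightarrow>
    (0, 0) \<in> S \<and>
    monotone_N4_path_between (0, 0) (x_max S, y_max S) (sorted_list_of_set (lower_boundary S)) \<and>
    monotone_N4_path_between (0, 0) (x_max S, y_max S) (sorted_list_of_set (upper_boundary S))"

end

theory Submission
  imports Defs
begin

text \<open>
  Along a monotone path any two points are comparable, and every point except the ends has a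
  predecessor and a successor one unit step away. Conversely, a finite chain from \<open>(0, 0)\<close> to
  \<open>(x_max, y_max)\<close> in which every other point has a unit-step successor is, in lexicographic
  order, a monotone path. The boundary conditions are therefore equivalent to a chain condition
  and a successor condition on the two boundaries.

  Axiom A1 links every point of \<open>S\<close> to the origin by a descending path inside \<open>S\<close>, which yields
  connectedness and a point of \<open>S\<close> weakly below \<open>A\<close> in every column left of \<open>A\<close>; with A2 this
  gives the chain and successor conditions. In the other direction, A1 comes from predecessors on
  the lower boundary, and A2 from pushing \<open>A\<close> to the end of its row or column, where it lies on a
  boundary and must be comparable with \<open>B\<close>. Reflection in the diagonal exchanges the two
  boundaries.
\<close>

section \<open>The inclusion order, chains and unit steps\<close>

lemma point_subseteq_pair [simp]: "(a, b) \<sqsubseteq>\<^sub>p (c, d) \<longleftrightarrow> a \<le> c \<and> b \<le> d"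
  by (simp add: point_subseteq_def)

lemma point_subset_pair [simp]: "(a, b) \<sqsubset>\<^sub>p (c, d) \<longleftrightarrow> a \<le> c \<and> b \<le> d \<and> (a, b) \<noteq> (c, d)"
  by (simp add: point_subset_def)

lemma point_subseteq_trans: "A \<sqsubseteq>\<^sub>p B \<Longrightarrow> B \<sqsubseteq>\<^sub>p C \<Longrightarrow> A \<sqsubseteq>\<^sub>p C"
  by (auto simp: point_subseteq_def)

lemma point_subseteq_imp_lex_le: "A \<sqsubseteq>\<^sub>p B \<Longrightarrow> A \<le> B"
  by (cases A; cases B) auto

definition is_chain :: "point set \<Rightarrow> bool" where
  "is_chain L \<longleftrightarrow> (\<forall>A\<in>L. \<forall>B\<in>L. A \<sqsubseteq>\<^sub>p B \<or> B \<sqsubseteq>\<^sub>p A)"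

text \<open>The lexicographic order extends inclusion, so on a chain the two agree. This turns
  sortedness of a list into inclusion of its points.\<close>

lemma is_chain_lex_le:
  assumes "is_chain L" "A \<in> L" "B \<in> L" "A \<le> B"
  shows "A \<sqsubseteq>\<^sub>p B"
proof (cases "A = B")
  case True
  then show ?thesis by (simp add: point_subseteq_def)
next
  case False
  then have "\<not> B \<sqsubseteq>\<^sub>p A" using assms(4) point_subseteq_imp_lex_le[of B A] by auto
  then show ?thesis using assms(1-3) unfolding is_chain_def by blast
qed

definition unit_step :: "point \<Rightarrow> point \<Rightarrow> bool" where
  "unit_step A B \<longleftrightarrow> B = (fst A + 1, snd A) \<or> B = (fst A, snd A + 1)"

text \<open>Among the four neighbours of \<open>A\<close> only the right and the upper one include
  \<open>A\<close>, so both conditions on a monotone path merge into one relation.\<close>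

lemma unit_step_iff: "unit_step A B \<longleftrightarrow> B \<in> N4 A \<and> A \<sqsubset>\<^sub>p B"
  by (cases A; cases B) (auto simp: unit_step_def)

section \<open>Monotone paths\<close>

lemma monotone_N4_path_iff:
  "monotone_N4_path ps \<longleftrightarrow>
    ps \<noteq> [] \<and> (\<forall>i. Suc i < length ps \<longrightarrow> unit_step (ps ! i) (ps ! Suc i))"
  by (auto simp: monotone_N4_path_def N4_path_def unit_step_iff)

text \<open>With \<open>successively\<close>, the rules for cons, append and reversal apply to
  paths; the proof of connectedness relies on them.\<close>

lemma N4_path_iff_successively:
  "N4_path ps \<longleftrightarrow> ps \<noteq> [] \<and> successively (\<lambda>A B. B \<in> N4 A) ps"
  by (auto simp: N4_path_def successively_conv_nth)

lemma monotone_N4_path_nth_mono: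
  assumes "monotone_N4_path ps" "i \<le> j" "j < length ps"
  shows "ps ! i \<sqsubseteq>\<^sub>p ps ! j"
  using assms(2,3)
proof (induction j rule: dec_induct)
  case base
  show ?case by (simp add: point_subseteq_def)
next
  case (step n)
  have "ps ! n \<sqsubseteq>\<^sub>p ps ! Suc n"
    using assms(1) step.prems by (auto simp: monotone_N4_path_def point_subset_def)
  with step show ?case by (auto intro: point_subseteq_trans)
qed

lemma monotone_N4_path_is_chain:
  assumes "monotone_N4_path ps"
  shows "is_chain (set ps)"
  unfolding is_chain_def
  by (metis assms in_set_conv_nth monotone_N4_path_nth_mono nle_le)

lemma monotone_N4_path_predecessor:
  assumes "monotone_N4_path ps" "A \<in> set ps" "A \<noteq> hd ps"
  shows "\<exists>B\<in>set ps. unit_step B A"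
proof -
  obtain i where i: "i < length ps" "ps ! i = A"
    using assms(2) by (auto simp: in_set_conv_nth)
  moreover have "i \<noteq> 0"
    using i assms(3) by (metis hd_conv_nth length_greater_0_conv)
  then obtain j where "i = Suc j" by (cases i) auto
  ultimately show ?thesis
    using assms(1) nth_mem[of j ps] by (auto simp: monotone_N4_path_iff)
qed

lemma monotone_N4_path_successor:
  assumes "monotone_N4_path ps" "A \<in> set ps" "A \<noteq> last ps"
  shows "\<exists>B\<in>set ps. unit_step A B"
proof -
  obtain i where i: "i < length ps" "ps ! i = A"
    using assms(2) by (auto simp: in_set_conv_nth)
  moreover have "Suc i \<noteq> length ps"
    using i assms(3) by (metis last_conv_nth diff_Suc_1 list.size(3) not_less0)
  ultimately have "Suc i < length ps" by simp
  then show ?thesis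
    using i assms(1) nth_mem[of "Suc i" ps] by (auto simp: monotone_N4_path_iff)
qed

text \<open>The entry \<open>?R\<close> after \<open>?P\<close> lies, by the chain condition,
  between \<open>?P\<close> and its unit-step successor \<open>Q\<close> in \<open>L\<close>.
  Nothing lies strictly between the ends of a unit step, so \<open>?R = Q\<close>.\<close>

lemma sorted_list_of_chain_monotone_N4_path:
  assumes fin: "finite L" and chain: "is_chain L"
    and A: "A \<in> L" "\<And>P. P \<in> L \<Longrightarrow> A \<sqsubseteq>\<^sub>p P"
    and B: "B \<in> L" "\<And>P. P \<in> L \<Longrightarrow> P \<sqsubseteq>\<^sub>p B"
    and succ: "\<And>P. P \<in> L \<Longrightarrow> P \<noteq> B \<Longrightarrow> \<exists>Q\<in>L. unit_step P Q"
  shows "monotone_N4_path_between A B (sorted_list_of_set L)"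
proof -
  let ?ps = "sorted_list_of_set L"
  have set_ps: "set ?ps = L" using fin by simp
  have ne: "?ps \<noteq> []" using A(1) set_ps by auto
  have sorted: "sorted_wrt (<) ?ps" by simp
  have "unit_step (?ps ! i) (?ps ! Suc i)" if i: "Suc i < length ?ps" for i
  proof -
    let ?P = "?ps ! i" and ?R = "?ps ! Suc i"
    have PR: "?P \<in> L" "?R \<in> L"
      using i set_ps nth_mem[of i ?ps] nth_mem[of "Suc i" ?ps] by simp_all
    have less: "?P < ?R"
      using sorted_wrt_nth_less[OF sorted, of i "Suc i"] i by simp
    \<comment> \<open>Every point of \<open>L\<close> is lexicographically at most \<open>B\<close>,
      whereas \<open>?R\<close> exceeds \<open>?P\<close>.\<close>
    then have "?P \<noteq> B"
      using point_subseteq_imp_lex_le[OF B(2)[OF PR(2)]] by auto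
    then obtain Q where Q: "Q \<in> L" "unit_step ?P Q" using succ PR(1) by blast
    then have PQ: "?P < Q" by (cases ?P) (auto simp: unit_step_def)
    obtain k where k: "k < length ?ps" "?ps ! k = Q"
      using Q(1) set_ps by (metis in_set_conv_nth)
    have "i < k"
    proof (rule ccontr)
      assume "\<not> i < k"
      then have "?ps ! k \<le> ?P"
        using i by (intro sorted_nth_mono) auto
      with PQ k show False by simp
    qed
    then have "?R \<le> Q" using k sorted_nth_mono[of ?ps "Suc i" k] by simp
    then have "?R \<sqsubseteq>\<^sub>p Q" using is_chain_lex_le[OF chain PR(2) Q(1)] by simp
    moreover have "?P \<sqsubseteq>\<^sub>p ?R" using is_chain_lex_le[OF chain PR] less by simp
    ultimately show ?thesis
      using less Q(2) by (cases ?P; cases ?R; cases Q) (auto simp: unit_step_def)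
  qed
  then have "monotone_N4_path ?ps" using ne by (simp add: monotone_N4_path_iff)
  moreover have "hd ?ps = A"
  proof -
    have "hd ?ps \<in> L" using hd_in_set[OF ne] set_ps by simp
    moreover have "hd ?ps \<le> A"
    proof -
      obtain k where k: "k < length ?ps" "?ps ! k = A"
        using A(1) set_ps by (metis in_set_conv_nth)
      then have "?ps ! 0 \<le> ?ps ! k" by (intro sorted_nth_mono) auto
      then show ?thesis using k(2) hd_conv_nth[OF ne] by simp
    qed
    ultimately show ?thesis
      using point_subseteq_imp_lex_le[OF A(2), of "hd ?ps"] by (intro order_antisym) simp_all
  qed
  moreover have "last ?ps = B"
  proof -
    have "last ?ps \<in> L" using last_in_set[OF ne] set_ps by simp
    moreover have "B \<le> last ?ps"
    proof -
      obtain k where k: "k < length ?ps" "?ps ! k = B"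
        using B(1) set_ps by (metis in_set_conv_nth)
      then have "?ps ! k \<le> ?ps ! (length ?ps - 1)" by (intro sorted_nth_mono) auto
      then show ?thesis using k(2) last_conv_nth[OF ne] by simp
    qed
    ultimately show ?thesis
      using point_subseteq_imp_lex_le[OF B(2), of "last ?ps"] by (intro order_antisym) simp_all
  qed
  ultimately show ?thesis by (simp add: monotone_N4_path_between_def)
qed

section \<open>Orthogonal convexity as convexity of rows and columns\<close>

text \<open>This betweenness form applies directly to two given points and is visibly invariant
  under exchanging the coordinates.\<close>

definition convex_lines :: "point set \<Rightarrow> bool" where
  "convex_lines S \<longleftrightarrow>
    (\<forall>a b c x. (a, c) \<in> S \<longrightarrow> (b, c) \<in> S \<longrightarrow> a \<le> x \<longrightarrow> x \<le> b \<longrightarrow> (x, c) \<in> S) \<and>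
    (\<forall>a b c y. (c, a) \<in> S \<longrightarrow> (c, b) \<in> S \<longrightarrow> a \<le> y \<longrightarrow> y \<le> b \<longrightarrow> (c, y) \<in> S)"

lemma convex_lines_row:
  assumes "convex_lines S" "(a, c) \<in> S" "(b, c) \<in> S" "a \<le> x" "x \<le> b"
  shows "(x, c) \<in> S"
  by (rule assms(1)[unfolded convex_lines_def, THEN conjunct1, rule_format, OF assms(2-5)])

lemma convex_lines_column:
  assumes "convex_lines S" "(c, a) \<in> S" "(c, b) \<in> S" "a \<le> y" "y \<le> b"
  shows "(c, y) \<in> S"
  by (rule assms(1)[unfolded convex_lines_def, THEN conjunct2, rule_format, OF assms(2-5)])

lemma convex_linesI:
  assumes "\<And>a b c x. (a, c) \<in> S \<Longrightarrow> (b, c) \<in> S \<Longrightarrow> a \<le> x \<Longrightarrow> x \<le> b \<Longrightarrow> (x, c) \<in> S"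
    and "\<And>a b c y. (c, a) \<in> S \<Longrightarrow> (c, b) \<in> S \<Longrightarrow> a \<le> y \<Longrightarrow> y \<le> b \<Longrightarrow> (c, y) \<in> S"
  shows "convex_lines S"
  unfolding convex_lines_def by (intro conjI allI impI) (fact assms)+

lemma finite_convex_int_set:
  fixes T :: "int set"
  assumes "finite T" "\<And>a b x. a \<in> T \<Longrightarrow> b \<in> T \<Longrightarrow> a \<le> x \<Longrightarrow> x \<le> b \<Longrightarrow> x \<in> T"
  shows "T = {} \<or> (\<exists>a b. T = {a..b})"
proof (cases "T = {}")
  case False
  then have "Min T \<in> T" "Max T \<in> T" using assms(1) by auto
  then have "{Min T..Max T} \<subseteq> T" using assms(2) by (meson atLeastAtMost_iff subsetI)
  moreover have "T \<subseteq> {Min T..Max T}" using assms(1) by auto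
  ultimately show ?thesis by blast
qed simp

lemma finite_row: "finite S \<Longrightarrow> finite {x. (x, c) \<in> S}"
  by (rule finite_subset[of _ "fst ` S"]) force+

lemma finite_column: "finite S \<Longrightarrow> finite {y. (c, y) \<in> S}"
  by (rule finite_subset[of _ "snd ` S"]) force+

lemma interval_row_convex:
  assumes "R = {} \<or> (\<exists>P. R = {P}) \<or> (\<exists>l u. R = {(x, c) | x. l \<le> x \<and> x \<le> u})"
    and "(a, c) \<in> R" "(b, c) \<in> R" "a \<le> x" "x \<le> (b :: int)"
  shows "(x, c) \<in> R"
  using assms by (elim disjE exE) simp_all

lemma interval_column_convex:
  assumes "R = {} \<or> (\<exists>P. R = {P}) \<or> (\<exists>l u. R = {(c, y) | y. l \<le> y \<and> y \<le> u})"
    and "(c, a) \<in> R" "(c, b) \<in> R" "a \<le> y" "y \<le> (b :: int)"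
  shows "(c, y) \<in> R"
  using assms by (elim disjE exE) simp_all

text \<open>Finiteness gives each nonempty row and column two ends: a half-line would be convex, but
  is not of the form that \<open>orthogonally_convex\<close> demands.\<close>

lemma orthogonally_convex_iff:
  assumes "finite S"
  shows "orthogonally_convex S \<longleftrightarrow> convex_lines S"
proof
  assume oc: "orthogonally_convex S"
  have "(x, c) \<in> S" if h: "(a, c) \<in> S" "(b, c) \<in> S" "a \<le> x" "x \<le> b" for a b c x
  proof -
    have mem: "(z, c) \<in> S \<longleftrightarrow> (z, c) \<in> S \<inter> horizontal_line c" for z
      by (simp add: horizontal_line_def)
    have "(x, c) \<in> S \<inter> horizontal_line c"
      using oc[unfolded orthogonally_convex_def, THEN conjunct1, THEN spec, of c]
        h(1)[unfolded mem] h(2)[unfolded mem] h(3,4) by (rule interval_row_convex)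
    then show ?thesis by simp
  qed
  moreover have "(c, y) \<in> S" if h: "(c, a) \<in> S" "(c, b) \<in> S" "a \<le> y" "y \<le> b" for a b c y
  proof -
    have mem: "(c, z) \<in> S \<longleftrightarrow> (c, z) \<in> S \<inter> vertical_line c" for z
      by (simp add: vertical_line_def)
    have "(c, y) \<in> S \<inter> vertical_line c"
      using oc[unfolded orthogonally_convex_def, THEN conjunct2, THEN spec, of c]
        h(1)[unfolded mem] h(2)[unfolded mem] h(3,4) by (rule interval_column_convex)
    then show ?thesis by simp
  qed
  ultimately show "convex_lines S" by (rule convex_linesI)
next
  assume cl: "convex_lines S"
  have "S \<inter> horizontal_line c = {} \<or> (\<exists>P. S \<inter> horizontal_line c = {P}) \<or>
      (\<exists>a b. S \<inter> horizontal_line c = {(x, c) | x. a \<le> x \<and> x \<le> b})" for c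
  proof -
    let ?T = "{x. (x, c) \<in> S}"
    have "finite ?T" using assms by (rule finite_row)
    moreover have "z \<in> ?T" if "a \<in> ?T" "b \<in> ?T" "a \<le> z" "z \<le> b" for a b z
      using convex_lines_row[OF cl, of a c b z] that by simp
    ultimately have T: "?T = {} \<or> (\<exists>a b. ?T = {a..b})"
      by (rule finite_convex_int_set)
    have line: "S \<inter> horizontal_line c = (\<lambda>x. (x, c)) ` ?T"
      by (auto simp: horizontal_line_def)
    from T show ?thesis
    proof (elim disjE exE)
      assume "?T = {}"
      then show ?thesis unfolding line by simp
    next
      fix a b assume "?T = {a..b}"
      then have "S \<inter> horizontal_line c = {(x, c) | x. a \<le> x \<and> x \<le> b}"
        unfolding line by (simp only: image_def atLeastAtMost_iff) auto
      then show ?thesis by (intro disjI2 exI)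
    qed
  qed
  moreover have "S \<inter> vertical_line c = {} \<or> (\<exists>P. S \<inter> vertical_line c = {P}) \<or>
      (\<exists>a b. S \<inter> vertical_line c = {(c, y) | y. a \<le> y \<and> y \<le> b})" for c
  proof -
    let ?T = "{y. (c, y) \<in> S}"
    have "finite ?T" using assms by (rule finite_column)
    moreover have "z \<in> ?T" if "a \<in> ?T" "b \<in> ?T" "a \<le> z" "z \<le> b" for a b z
      using convex_lines_column[OF cl, of c a b z] that by simp
    ultimately have T: "?T = {} \<or> (\<exists>a b. ?T = {a..b})"
      by (rule finite_convex_int_set)
    have line: "S \<inter> vertical_line c = (\<lambda>y. (c, y)) ` ?T"
      by (auto simp: vertical_line_def)
    from T show ?thesis
    proof (elim disjE exE)
      assume "?T = {}"
      then show ?thesis unfolding line by simp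
    next
      fix a b assume "?T = {a..b}"
      then have "S \<inter> vertical_line c = {(c, y) | y. a \<le> y \<and> y \<le> b}"
        unfolding line by (simp only: image_def atLeastAtMost_iff) auto
      then show ?thesis by (intro disjI2 exI)
    qed
  qed
  ultimately show "orthogonally_convex S"
    unfolding orthogonally_convex_def by (intro conjI allI)
qed

section \<open>Reflection in the diagonal\<close>

lemma pair_in_swap_image [simp]: "(x, y) \<in> prod.swap ` S \<longleftrightarrow> (y, x) \<in> S"
  by force

lemma swap_point_subseteq [simp]: "prod.swap A \<sqsubseteq>\<^sub>p prod.swap B \<longleftrightarrow> A \<sqsubseteq>\<^sub>p B"
  by (auto simp: point_subseteq_def)

lemma swap_unit_step [simp]: "unit_step (prod.swap A) (prod.swap B) \<longleftrightarrow> unit_step A B"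
  by (cases A; cases B) (auto simp: unit_step_def)

lemma swap_is_chain [simp]: "is_chain (prod.swap ` L) \<longleftrightarrow> is_chain L"
  by (simp add: is_chain_def)

lemma swap_convex_lines [simp]: "convex_lines (prod.swap ` S) \<longleftrightarrow> convex_lines S"
  unfolding convex_lines_def pair_in_swap_image by (rule conj_commute)

text \<open>The right, lower and lower right neighbours are reflected to the upper, left and upper
  left ones, so each result on lower boundaries yields one on upper boundaries.\<close>

lemma lower_boundary_swap: "lower_boundary (prod.swap ` S) = prod.swap ` upper_boundary S"
  by (auto simp: lower_boundary_def upper_boundary_def)

lemma x_max_swap: "x_max (prod.swap ` S) = y_max S"
  and y_max_swap: "y_max (prod.swap ` S) = x_max S"
  by (simp_all add: x_max_def y_max_def image_image)

text \<open>Reflection exchanges the alternatives in A1 and in the first clause of A2, and it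
  exchanges the last two clauses of A2.\<close>

lemma antimatroidal_point_set_swap:
  assumes "antimatroidal_point_set S"
  shows "antimatroidal_point_set (prod.swap ` S)"
proof -
  have "antimatroidal_A1 (prod.swap ` S)"
    using assms unfolding antimatroidal_point_set_def antimatroidal_A1_def by fastforce
  moreover have "antimatroidal_A2 (prod.swap ` S)"
    using assms unfolding antimatroidal_point_set_def antimatroidal_A2_def by fastforce
  ultimately show ?thesis using assms by (simp add: antimatroidal_point_set_def)
qed

section \<open>Consequences of the axioms\<close>

text \<open>A1 lowers the coordinate sum by one and stays in \<open>S\<close>. Since
  \<open>S\<close> is finite this must stop, and it can stop only at the origin.\<close>

lemma antimatroidal_A1_induct [consumes 3, case_names origin right up]:
  assumes "finite S" "antimatroidal_A1 S" "(x, y) \<in> S"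
    and "(0, 0) \<in> S \<Longrightarrow> P 0 0"
    and right: "\<And>x y. (x, y) \<in> S \<Longrightarrow> (x - 1, y) \<in> S \<Longrightarrow> P (x - 1) y \<Longrightarrow> P x y"
    and up: "\<And>x y. (x, y) \<in> S \<Longrightarrow> (x, y - 1) \<in> S \<Longrightarrow> P x (y - 1) \<Longrightarrow> P x y"
  shows "P x y"
proof -
  \<comment> \<open>Coordinates are not known to be nonnegative here; subtracting the least
    coordinate sum makes \<open>nat\<close> a strictly decreasing measure.\<close>
  define m where "m = Min ((\<lambda>(x, y). x + y) ` S)"
  have m: "m \<le> x + y" if "(x, y) \<in> S" for x y
    unfolding m_def using assms(1) that by (intro Min_le) force+
  show ?thesis using assms(3)
  proof (induction "nat (x + y - m)" arbitrary: x y rule: less_induct)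
    case less
    consider "(x, y) = (0, 0)" | "(x - 1, y) \<in> S" | "(x, y - 1) \<in> S"
      using assms(2) less.prems unfolding antimatroidal_A1_def by blast
    then show ?case
    proof cases
      case 1
      then show ?thesis using assms(4) less.prems by simp
    next
      case 2
      then have "P (x - 1) y" using m by (intro less.hyps) fastforce+
      then show ?thesis using right less.prems 2 by blast
    next
      case 3
      then have "P x (y - 1)" using m by (intro less.hyps) fastforce+
      then show ?thesis using up less.prems 3 by blast
    qed
  qed
qed

locale antimatroidal =
  fixes S :: "point set"
  assumes antimatroidal: "antimatroidal_point_set S"
begin

lemma finite: "finite S" and nonempty: "S \<noteq> {}"
  and A1: "antimatroidal_A1 S" and A2: "antimatroidal_A2 S"
  using antimatroidal by (auto simp: antimatroidal_point_set_def)

text \<open>Interpreting the locale at the reflected set gives facts on rows and the lower boundary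
  a twin for columns and the upper boundary.\<close>

lemma swap: "antimatroidal (prod.swap ` S)"
  using antimatroidal by unfold_locales (rule antimatroidal_point_set_swap)

lemma step_right:
  assumes "(a, b) \<in> S" "(x, y) \<in> S" "x < a" "b \<le> y"
  shows "(x + 1, y) \<in> S"
  using A2 assms unfolding antimatroidal_A2_def by fastforce

lemma step_up:
  assumes "(a, b) \<in> S" "(x, y) \<in> S" "a \<le> x" "y < b"
  shows "(x, y + 1) \<in> S"
  using A2 assms unfolding antimatroidal_A2_def by fastforce

lemma step_either:
  assumes "(a, b) \<in> S" "(x, y) \<in> S" "x \<le> a" "y \<le> b" "(x, y) \<noteq> (a, b)"
  shows "(x + 1, y) \<in> S \<or> (x, y + 1) \<in> S"
proof -
  have "\<not> (a, b) \<sqsubseteq>\<^sub>p (x, y)" using assms by auto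
  then show ?thesis using A2 assms unfolding antimatroidal_A2_def by blast
qed

text \<open>The induction runs with a predicate that ignores the point: descent from any point ends
  at the origin.\<close>

lemma origin_mem: "(0, 0) \<in> S"
proof -
  obtain x y where "(x, y) \<in> S" using nonempty by auto
  with finite A1 show ?thesis by (induction rule: antimatroidal_A1_induct)
qed

lemma nonneg:
  assumes "(x, y) \<in> S"
  shows "0 \<le> x" "0 \<le> y"
proof -
  have "0 \<le> x \<and> 0 \<le> y"
    using finite A1 assms by (induction rule: antimatroidal_A1_induct) auto
  then show "0 \<le> x" "0 \<le> y" by auto
qed

text \<open>A descending path from \<open>(a, b)\<close> to the origin crosses every column in
  between, never above height \<open>b\<close>.\<close>

lemma column_below:
  assumes "(a, b) \<in> S" "0 \<le> x" "x \<le> a"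
  shows "\<exists>y\<le>b. (x, y) \<in> S"
  using finite A1 assms(1) assms(3)
proof (induction rule: antimatroidal_A1_induct)
  case origin
  then show ?case using assms(2) by auto
next
  case (right a b)
  then show ?case by (cases "x = a") auto
next
  case (up a b)
  then obtain y where "y \<le> b - 1" "(x, y) \<in> S" by blast
  then show ?case by (intro exI[of _ y]) simp
qed

text \<open>A2 allows a step right towards a point of the same height, so one can walk along the row
  from the left point to the right one.\<close>

lemma convex_row:
  assumes "(a, c) \<in> S" "(b, c) \<in> S" "a \<le> x" "x \<le> b"
  shows "(x, c) \<in> S"
  using assms(3,4)
proof (induction x rule: int_ge_induct)
  case base
  show ?case by (fact assms(1))
next
  case (step i)
  then show ?case using step_right[OF assms(2), of i c] by simp
qed

lemma convex_lines: "convex_lines S"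
proof -
  interpret sw: antimatroidal "prod.swap ` S" by (rule swap)
  have "(c, y) \<in> S" if "(c, a) \<in> S" "(c, b) \<in> S" "a \<le> y" "y \<le> b" for a b c y
    using sw.convex_row[of a c b y] that by simp
  with convex_row show ?thesis by (rule convex_linesI)
qed

lemma convex_column:
  assumes "(c, a) \<in> S" "(c, b) \<in> S" "a \<le> y" "y \<le> b"
  shows "(c, y) \<in> S"
  using convex_lines assms by (rule convex_lines_column)

lemma le_max:
  assumes "(x, y) \<in> S"
  shows "x \<le> x_max S" "y \<le> y_max S"
  unfolding x_max_def y_max_def using finite assms by (auto intro!: Max_ge rev_image_eqI)

text \<open>The lexicographic maximum of \<open>S\<close> has the largest first coordinate. If some
  point were higher, A2 would put the point directly above the maximum into
  \<open>S\<close>.\<close>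

lemma max_mem: "(x_max S, y_max S) \<in> S"
proof -
  obtain a b where ab: "Max S = (a, b)" by force
  then have mem: "(a, b) \<in> S" using Max_in[OF finite nonempty] by simp
  have lex: "(x, y) \<le> (a, b)" if "(x, y) \<in> S" for x y
    using Max_ge[OF finite that] ab by simp
  have x: "x \<le> a" if "(x, y) \<in> S" for x y using lex[OF that] by auto
  have y: "y \<le> b" if "(x, y) \<in> S" for x y
  proof (rule ccontr)
    assume "\<not> y \<le> b"
    then have "(a, b + 1) \<in> S" using step_up[OF that mem] x[OF that] by simp
    then show False using lex by fastforce
  qed
  have "x_max S = a" unfolding x_max_def using finite mem x by (intro Max_eqI) force+
  moreover have "y_max S = b" unfolding y_max_def using finite mem y by (intro Max_eqI) force+
  ultimately show ?thesis using mem by simp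
qed

lemma N4_connected: "N4_connected S"
proof -
  let ?path = "\<lambda>A B ps. N4_path ps \<and> hd ps = A \<and> last ps = B \<and> set ps \<subseteq> S"
  have to_origin: "\<exists>ps. ?path (x, y) (0, 0) ps" if "(x, y) \<in> S" for x y
    using finite A1 that
  proof (induction rule: antimatroidal_A1_induct)
    case origin
    then have "?path (0, 0) (0, 0) [(0, 0)]" by (simp add: N4_path_iff_successively)
    then show ?case by blast
  next
    case (right x y)
    then obtain ps where "?path (x - 1, y) (0, 0) ps" by blast
    then have "?path (x, y) (0, 0) ((x, y) # ps)"
      using right by (auto simp: N4_path_iff_successively successively_Cons)
    then show ?case by blast
  next
    case (up x y)
    then obtain ps where "?path (x, y - 1) (0, 0) ps" by blast
    then have "?path (x, y) (0, 0) ((x, y) # ps)"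
      using up by (auto simp: N4_path_iff_successively successively_Cons)
    then show ?case by blast
  qed
  have N4_sym: "A \<in> N4 B \<longleftrightarrow> B \<in> N4 A" for A B by (cases A; cases B) auto
  have "\<exists>ps. ?path A B ps" if AB: "A \<in> S" "B \<in> S" for A B
  proof -
    obtain ps where ps: "?path A (0, 0) ps" using to_origin[of "fst A" "snd A"] AB by auto
    obtain qs where qs: "?path B (0, 0) qs" using to_origin[of "fst B" "snd B"] AB by auto
    then have rev: "?path (0, 0) B (rev qs)"
      by (auto simp: N4_path_iff_successively N4_sym hd_rev last_rev)
    \<comment> \<open>The origin ends \<open>ps\<close> and starts \<open>rev qs\<close>. Its second
      copy is dropped, since repeating a point is not an \<open>N4\<close> step.\<close>
    then obtain rs where rs: "rev qs = (0, 0) # rs"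
      by (cases "rev qs") (auto simp: N4_path_iff_successively)
    have "?path A B (ps @ rs)"
      using ps rev unfolding rs
      by (auto simp: N4_path_iff_successively successively_append_iff successively_Cons
          split: if_splits)
    then show ?thesis by blast
  qed
  then show ?thesis unfolding N4_connected_def by blast
qed

section \<open>The boundaries of an antimatroidal point set\<close>

text \<open>A point of \<open>S\<close> strictly to the right of and below \<open>(x, y)\<close>
  forces all three neighbours that define the lower boundary into \<open>S\<close>.\<close>

lemma lower_boundary_is_chain: "is_chain (lower_boundary S)"
proof -
  have False
    if P: "(x, y) \<in> lower_boundary S" and Q: "(a, b) \<in> S" and less: "x < a" "b < y" for x y a b
  proof -
    have mem: "(x, y) \<in> S" using P by (simp add: lower_boundary_def)
    have right: "(x + 1, y) \<in> S" using step_right[OF Q mem] less by simp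
    \<comment> \<open>Used for both columns \<open>x\<close> and \<open>x + 1\<close>: each contains
      a point no higher than \<open>b < y\<close>, and column convexity fills the gap.\<close>
    have "(z, y - 1) \<in> S" if z: "(z, y) \<in> S" "z \<le> a" for z
    proof -
      obtain c where "c \<le> b" "(z, c) \<in> S"
        using column_below[OF Q _ z(2)] nonneg(1)[OF z(1)] by blast
      then show ?thesis using convex_column[of z c y "y - 1"] z less by simp
    qed
    from this[OF mem] this[OF right] show False
      using P right less by (auto simp: lower_boundary_def)
  qed
  moreover have "lower_boundary S \<subseteq> S" by (auto simp: lower_boundary_def)
  ultimately have "A \<sqsubseteq>\<^sub>p B \<or> B \<sqsubseteq>\<^sub>p A"
    if "A \<in> lower_boundary S" "B \<in> lower_boundary S" for A B
    using that by (cases A; cases B) (fastforce simp: not_le)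
  then show ?thesis unfolding is_chain_def by blast
qed

lemma lower_boundary_successor:
  assumes "P \<in> lower_boundary S" "P \<noteq> (x_max S, y_max S)"
  shows "\<exists>Q\<in>lower_boundary S. unit_step P Q"
proof -
  obtain x y where P: "P = (x, y)" by force
  have mem: "(x, y) \<in> S" using assms(1) P by (simp add: lower_boundary_def)
  show ?thesis
  proof (cases "(x + 1, y) \<in> S")
    case False
    then have "(x, y + 1) \<in> S"
      using step_either[OF max_mem mem] le_max[OF mem] assms(2) P by auto
    \<comment> \<open>The missing \<open>(x + 1, y)\<close> is the lower right neighbour of
      \<open>(x, y + 1)\<close>.\<close>
    then have "(x, y + 1) \<in> lower_boundary S" using False by (simp add: lower_boundary_def)
    then show ?thesis using P by (force simp: unit_step_def)
  next
    case True
    \<comment> \<open>Otherwise column \<open>x\<close> would also contain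
      \<open>(x, y - 1)\<close>, and \<open>P\<close> would not be on the boundary.\<close>
    have "(x + 1, y - 1) \<notin> S"
    proof
      assume below: "(x + 1, y - 1) \<in> S"
      then obtain c where "c \<le> y - 1" "(x, c) \<in> S"
        using column_below[OF below, of x] nonneg(1)[OF mem] by auto
      then have "(x, y - 1) \<in> S" using convex_column[of x c y "y - 1"] mem by simp
      then show False using assms(1) P True below by (simp add: lower_boundary_def)
    qed
    then have "(x + 1, y) \<in> lower_boundary S" using True by (simp add: lower_boundary_def)
    then show ?thesis using P by (force simp: unit_step_def)
  qed
qed

lemma origin_in_lower_boundary: "(0, 0) \<in> lower_boundary S"
  using origin_mem nonneg(2)[of 0 "-1"] by (auto simp: lower_boundary_def)

lemma max_in_lower_boundary: "(x_max S, y_max S) \<in> lower_boundary S"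
  using max_mem le_max(1)[of "x_max S + 1" "y_max S"] by (auto simp: lower_boundary_def)

lemma bounded_by_monotone_N4_paths: "bounded_by_monotone_N4_paths S"
proof -
  \<comment> \<open>Facts on the lower boundary of the reflected set are swapped back into facts on
    the upper boundary of \<open>S\<close>.\<close>
  interpret sw: antimatroidal "prod.swap ` S" by (rule swap)
  have sub: "lower_boundary S \<subseteq> S" "upper_boundary S \<subseteq> S"
    by (auto simp: lower_boundary_def upper_boundary_def)
  have fin: "finite (lower_boundary S)" "finite (upper_boundary S)"
    using sub finite finite_subset by blast+
  have bounds: "(0, 0) \<sqsubseteq>\<^sub>p P" "P \<sqsubseteq>\<^sub>p (x_max S, y_max S)" if "P \<in> S" for P
    using that nonneg le_max by (cases P; simp)+
  have "is_chain (upper_boundary S)"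
    using sw.lower_boundary_is_chain by (simp add: lower_boundary_swap)
  moreover have "(0, 0) \<in> upper_boundary S"
    using sw.origin_in_lower_boundary by (simp add: lower_boundary_swap)
  moreover have "(x_max S, y_max S) \<in> upper_boundary S"
    using sw.max_in_lower_boundary by (simp add: lower_boundary_swap x_max_swap y_max_swap)
  moreover have "\<exists>Q\<in>upper_boundary S. unit_step P Q"
    if "P \<in> upper_boundary S" "P \<noteq> (x_max S, y_max S)" for P
  proof -
    have "prod.swap P \<in> lower_boundary (prod.swap ` S)"
      using that(1) by (simp add: lower_boundary_swap)
    moreover have "prod.swap P \<noteq> (x_max (prod.swap ` S), y_max (prod.swap ` S))"
      using that(2) by (cases P) (auto simp: x_max_swap y_max_swap)
    ultimately obtain Q where "Q \<in> upper_boundary S" "unit_step (prod.swap P) (prod.swap Q)"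
      using sw.lower_boundary_successor[of "prod.swap P"] unfolding lower_boundary_swap by blast
    then show ?thesis by auto
  qed
  ultimately have "monotone_N4_path_between (0, 0) (x_max S, y_max S)
      (sorted_list_of_set (upper_boundary S))"
    using fin(2) bounds sub(2) by (intro sorted_list_of_chain_monotone_N4_path) auto
  moreover have "monotone_N4_path_between (0, 0) (x_max S, y_max S)
      (sorted_list_of_set (lower_boundary S))"
    using fin(1) bounds sub(1) lower_boundary_is_chain origin_in_lower_boundary
      max_in_lower_boundary lower_boundary_successor
    by (intro sorted_list_of_chain_monotone_N4_path) auto
  ultimately show ?thesis
    using origin_mem by (simp add: bounded_by_monotone_N4_paths_def)
qed

end

section \<open>From boundary paths back to the axioms\<close>

lemma step_right_if_lower_boundary_chain:
  assumes "finite S" "convex_lines S" "is_chain (lower_boundary S)"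
    and A: "(a, b) \<in> S" and B: "(x, y) \<in> S" and less: "x < a" "b \<le> y"
  shows "(x + 1, y) \<in> S"
proof (rule ccontr)
  assume not_right: "(x + 1, y) \<notin> S"
  then have B_lower: "(x, y) \<in> lower_boundary S" using B by (simp add: lower_boundary_def)
  let ?T = "{c. (c, b) \<in> S}"
  have fin: "finite ?T" using assms(1) by (rule finite_row)
  \<comment> \<open>The right end of the row of \<open>(a, b)\<close> has no right neighbour, hence
    lies on the lower boundary.\<close>
  define m where "m = Max ?T"
  have m: "(m, b) \<in> S" "a \<le> m" using Max_in[OF fin] Max_ge[OF fin] A m_def by auto
  have "(m + 1, b) \<notin> S" using Max_ge[OF fin, of "m + 1"] m_def by auto
  then have "(m, b) \<in> lower_boundary S" using m by (simp add: lower_boundary_def)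
  then have "(m, b) \<sqsubseteq>\<^sub>p (x, y) \<or> (x, y) \<sqsubseteq>\<^sub>p (m, b)"
    using assms(3) B_lower unfolding is_chain_def by blast
  \<comment> \<open>Since \<open>x < a \<le> m\<close>, only the second inclusion is possible, and
    it gives \<open>y \<le> b\<close>.\<close>
  then have "b = y" using less m by auto
  moreover have "x + 1 \<le> a" using less by simp
  moreover have "x \<le> x + 1" by simp
  ultimately have "(x + 1, y) \<in> S"
    using convex_lines_row[OF assms(2) B, of a "x + 1"] A by simp
  with not_right show False by contradiction
qed

lemma antimatroidal_if_bounded_by_paths:
  assumes "finite S" "convex_lines S" "bounded_by_monotone_N4_paths S"
  shows "antimatroidal_point_set S"
proof -
  let ?M = "(x_max S, y_max S)"
  have sub: "lower_boundary S \<subseteq> S" "upper_boundary S \<subseteq> S"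
    by (auto simp: lower_boundary_def upper_boundary_def)
  have fin: "finite (lower_boundary S)" "finite (upper_boundary S)"
    using sub assms(1) finite_subset by blast+
  have origin: "(0, 0) \<in> S"
    and lower: "monotone_N4_path (sorted_list_of_set (lower_boundary S))"
      "hd (sorted_list_of_set (lower_boundary S)) = (0, 0)"
      "last (sorted_list_of_set (lower_boundary S)) = ?M"
    and upper: "monotone_N4_path (sorted_list_of_set (upper_boundary S))"
    using assms(3)
    by (auto simp: bounded_by_monotone_N4_paths_def monotone_N4_path_between_def)
  have le_M: "x \<le> x_max S" "y \<le> y_max S" if "(x, y) \<in> S" for x y
    unfolding x_max_def y_max_def using assms(1) that by (auto intro!: Max_ge rev_image_eqI)
  have chains: "is_chain (lower_boundary S)" "is_chain (upper_boundary S)"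
    using monotone_N4_path_is_chain[OF lower(1)] monotone_N4_path_is_chain[OF upper] fin by auto
  have "(x - 1, y) \<in> S \<or> (x, y - 1) \<in> S" if P: "(x, y) \<in> S" "(x, y) \<noteq> (0, 0)" for x y
  proof (rule disjCI)
    assume "(x, y - 1) \<notin> S"
    then have "(x, y) \<in> lower_boundary S" using P by (simp add: lower_boundary_def)
    \<comment> \<open>The path starts at the origin, so any other boundary point has a predecessor;
      with the point below missing, it is the left neighbour.\<close>
    then obtain Q where "Q \<in> S" "unit_step Q (x, y)"
      using monotone_N4_path_predecessor[OF lower(1), of "(x, y)"] lower(2) P(2) fin sub by auto
    with \<open>(x, y - 1) \<notin> S\<close> show "(x - 1, y) \<in> S" by (cases Q) (auto simp: unit_step_def)
  qed
  then have "antimatroidal_A1 S" unfolding antimatroidal_A1_def by blast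
  moreover have "antimatroidal_A2 S"
  proof -
    have right: "(x + 1, y) \<in> S"
      if "(a, b) \<in> S" "(x, y) \<in> S" "x < a" "b \<le> y" for a b x y
      using step_right_if_lower_boundary_chain[OF assms(1,2) chains(1)] that by blast
    \<comment> \<open>In the reflected set this is a step right, and the chain condition needed is
      the one on the upper boundary.\<close>
    have up: "(x, y + 1) \<in> S"
      if "(a, b) \<in> S" "(x, y) \<in> S" "a \<le> x" "y < b" for a b x y
      using step_right_if_lower_boundary_chain[of "prod.swap ` S" b a y x] assms(1,2) chains(2) that
      by (simp add: lower_boundary_swap)
    have either: "(x + 1, y) \<in> S \<or> (x, y + 1) \<in> S"
      if h: "(a, b) \<in> S" "(x, y) \<in> S" "x \<le> a" "y \<le> b" "\<not> (a, b) \<sqsubseteq>\<^sub>p (x, y)" for a b x y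
    proof (cases "(x + 1, y) \<in> S")
      case False
      then have "(x, y) \<in> lower_boundary S" using h by (simp add: lower_boundary_def)
      \<comment> \<open>Every point of \<open>S\<close> is included in \<open>?M\<close>, but
        \<open>(a, b)\<close> is not included in \<open>(x, y)\<close>. Hence the path continues
        beyond \<open>(x, y)\<close>, and it can only go up.\<close>
      moreover have "(x, y) \<noteq> ?M" using h le_M[OF h(1)] by auto
      ultimately obtain Q where "Q \<in> S" "unit_step (x, y) Q"
        using monotone_N4_path_successor[OF lower(1), of "(x, y)"] lower(3) fin sub by auto
      with False show ?thesis by (auto simp: unit_step_def)
    qed simp
    have "(x\<^sub>A \<ge> x\<^sub>B \<and> y\<^sub>A \<ge> y\<^sub>B \<longrightarrow> (x\<^sub>B + 1, y\<^sub>B) \<in> S \<or> (x\<^sub>B, y\<^sub>B + 1) \<in> S) \<and>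
        (x\<^sub>A \<le> x\<^sub>B \<and> y\<^sub>A \<ge> y\<^sub>B \<longrightarrow> (x\<^sub>B, y\<^sub>B + 1) \<in> S) \<and>
        (x\<^sub>A \<ge> x\<^sub>B \<and> y\<^sub>A \<le> y\<^sub>B \<longrightarrow> (x\<^sub>B + 1, y\<^sub>B) \<in> S)"
      if h: "(x\<^sub>A, y\<^sub>A) \<in> S" "(x\<^sub>B, y\<^sub>B) \<in> S" "\<not> (x\<^sub>A, y\<^sub>A) \<sqsubseteq>\<^sub>p (x\<^sub>B, y\<^sub>B)" for x\<^sub>A y\<^sub>A x\<^sub>B y\<^sub>B
      \<comment> \<open>In the last two clauses, failure of inclusion supplies the strict inequality
        that \<open>right\<close> and \<open>up\<close> require.\<close>
      using either[OF h(1,2) _ _ h(3)] right[OF h(1,2)] up[OF h(1,2)] h(3) by auto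
    then show ?thesis unfolding antimatroidal_A2_def by blast
  qed
  ultimately show ?thesis using assms(1) origin by (auto simp: antimatroidal_point_set_def)
qed

theorem theorem1:
  fixes S :: "(int \<times> int) set"
  assumes "finite S" and "S \<noteq> {}"
  shows "antimatroidal_point_set S \<longleftrightarrow>
    orthogonally_convex S \<and> N4_connected S \<and> bounded_by_monotone_N4_paths S"
proof
  assume "antimatroidal_point_set S"
  then interpret antimatroidal S by unfold_locales
  show "orthogonally_convex S \<and> N4_connected S \<and> bounded_by_monotone_N4_paths S"
    using convex_lines N4_connected bounded_by_monotone_N4_paths
    by (simp add: orthogonally_convex_iff[OF assms(1)])
next
  assume "orthogonally_convex S \<and> N4_connected S \<and> bounded_by_monotone_N4_paths S"
  then show "antimatroidal_point_set S"
    using assms antimatroidal_if_bounded_by_paths by (simp add: orthogonally_convex_iff)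
qed

end
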